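(* Let $I$ be a proper ideal of a ring $R$ and $M$ an $R$-module. Then $I\ltimes M$ is a quasi sdf-absorbing ideal of $R\ltimes M$ if and only if $I$ is a quasi sdf-absorbing ideal of $R$.
   Context: All rings are commutative with identity. An ideal $I$ of a ring $R$ is called sdf-absorbing if for all non-zero $a,b\in R$, $a^{2}-b^{2}\in I$ implies $a-b\in I$ or $a+b\in I$. A proper ideal $I$ of $R$ is called quasi sdf-absorbing if its radical $\sqrt{I}$ is an sdf-absorbing ideal of $R$. For an $R$-module $M$, the idealization $R\ltimes M=\{(r,m)\mid r\in R,\ m\in M\}$ is the ring with operations $(r_{1},m_{1})+(r_{2},m_{2})=(r_{1}+r_{2},m_{1}+m_{2})$ and $(r_{1},m_{1})(r_{2},m_{2})=(r_{1}r_{2},\,r_{1}m_{2}+r_{2}m_{1})$. For an ideal $I$ of $R$, $I\ltimes M=\{(r,m)\mid r\in I,\ m\in M\}$, which is an ideal of $R\ltimes M$. *)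

theory Defs
  imports "HOL-Algebra.Module" "HOL-Algebra.Ideal"
begin

definition radical :: "('a, 'm) ring_scheme \<Rightarrow> 'a set \<Rightarrow> 'a set"
  where "radical R I = {x \<in> carrier R. \<exists>n::nat. n > 0 \<and> x [^]\<^bsub>R\<^esub> n \<in> I}"

text \<open>Being sdf-absorbing does not by itself require the ideal to be proper.\<close>

locale sdf_absorbing_ideal = ideal + cring +
  assumes sdf_absorbing:
    "\<lbrakk>a \<in> carrier R; b \<in> carrier R; a \<noteq> \<zero>; b \<noteq> \<zero>;
      a [^] (2::nat) \<ominus> b [^] (2::nat) \<in> I\<rbrakk>
     \<Longrightarrow> a \<ominus> b \<in> I \<or> a \<oplus> b \<in> I"

locale quasi_sdf_absorbing_ideal = ideal + cring +
  assumes I_proper: "I \<noteq> carrier R"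
    and radical_sdf_absorbing: "sdf_absorbing_ideal (radical R I) R"

definition idealization ::
    "('a, 'm) ring_scheme \<Rightarrow> ('a, 'b, 'n) module_scheme \<Rightarrow> ('a \<times> 'b) ring"
  where "idealization R M =
    \<lparr>carrier = carrier R \<times> carrier M,
     mult = (\<lambda>(r1, m1) (r2, m2).
       (r1 \<otimes>\<^bsub>R\<^esub> r2, r1 \<odot>\<^bsub>M\<^esub> m2 \<oplus>\<^bsub>M\<^esub> r2 \<odot>\<^bsub>M\<^esub> m1)),
     one = (\<one>\<^bsub>R\<^esub>, \<zero>\<^bsub>M\<^esub>),
     zero = (\<zero>\<^bsub>R\<^esub>, \<zero>\<^bsub>M\<^esub>),
     add = (\<lambda>(r1, m1) (r2, m2). (r1 \<oplus>\<^bsub>R\<^esub> r2, m1 \<oplus>\<^bsub>M\<^esub> m2))\<rparr>"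

definition idealization_ideal :: "'a set \<Rightarrow> ('a, 'b, 'n) module_scheme \<Rightarrow> ('a \<times> 'b) set"
  where "idealization_ideal I M = {(r, m). r \<in> I \<and> m \<in> carrier M}"

lemma (in module) cring_idealization: "cring (idealization R M)"
proof (rule cringI)
  show "abelian_group (idealization R M)"
  proof (rule abelian_groupI)
    fix x assume "x \<in> carrier (idealization R M)"
    then show "\<exists>y\<in>carrier (idealization R M).
        y \<oplus>\<^bsub>idealization R M\<^esub> x = \<zero>\<^bsub>idealization R M\<^esub>"
      by (intro bexI[where x = "(\<ominus> fst x, \<ominus>\<^bsub>M\<^esub> snd x)"])
        (auto simp: idealization_def R.l_neg M.l_neg)
  qed (auto simp: idealization_def R.a_ac M.a_ac)
  show "comm_monoid (idealization R M)"
    by (rule comm_monoidI)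
      (auto simp: idealization_def R.m_ac M.a_ac smult_r_distr smult_assoc1[symmetric])
qed (auto simp: idealization_def R.l_distr smult_l_distr smult_r_distr M.a_ac)

lemma (in module) ideal_idealization_ideal:
  assumes "ideal I R"
  shows "ideal (idealization_ideal I M) (idealization R M)"
proof -
  interpret I: ideal I R by fact
  interpret S: cring "idealization R M" by (rule cring_idealization)
  show ?thesis
  proof (rule idealI)
    show "ring (idealization R M)" by (rule S.ring_axioms)
    show "subgroup (idealization_ideal I M) (add_monoid (idealization R M))"
    proof (rule S.add.subgroupI)
      show "idealization_ideal I M \<subseteq> carrier (idealization R M)"
        by (auto simp: idealization_def idealization_ideal_def)
      show "idealization_ideal I M \<noteq> {}"
        using additive_subgroup.zero_closed[OF I.is_additive_subgroup] M.zero_closed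
        unfolding idealization_ideal_def by blast
      fix x assume x: "x \<in> idealization_ideal I M"
      then obtain r m where rm: "x = (r, m)" "r \<in> I" "m \<in> carrier M"
        by (auto simp: idealization_ideal_def)
      have "\<ominus>\<^bsub>idealization R M\<^esub> x = (\<ominus> r, \<ominus>\<^bsub>M\<^esub> m)"
        by (rule S.minus_equality)
          (use rm I.Icarr in \<open>auto simp: idealization_def R.l_neg M.l_neg\<close>)
      then show "\<ominus>\<^bsub>idealization R M\<^esub> x \<in> idealization_ideal I M"
        using rm by (auto simp: idealization_ideal_def I.a_inv_closed)
    next
      fix x y assume "x \<in> idealization_ideal I M" "y \<in> idealization_ideal I M"
      then show "x \<oplus>\<^bsub>idealization R M\<^esub> y \<in> idealization_ideal I M"
        by (auto simp: idealization_def idealization_ideal_def I.a_closed)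
    qed
  qed (auto simp: idealization_def idealization_ideal_def I.I_l_closed I.I_r_closed I.Icarr)
qed

end

theory Submission
  imports Defs "HOL-Algebra.QuotRing"
begin

text \<open>The first projection is multiplicative, so \<open>radical (I \<ltimes> M) = radical I \<ltimes> M\<close>, and
  the condition on pairs reduces to the condition on first components. The only pairs not
  covered directly are the non-zero ones with first component zero; for these the claim
  holds because \<open>b\<^sup>2 \<in> radical I\<close> already gives \<open>b \<in> radical I\<close>.\<close>

text \<open>If \<open>n\<close> is an exponent for \<open>x [^] 2\<close>, then \<open>2 * n\<close>
  is one for \<open>x\<close>.\<close>

lemma (in ring) mem_radical_of_square:
  assumes "x \<in> carrier R" and "x [^] (2::nat) \<in> radical R I"
  shows "x \<in> radical R I"
proof -
  obtain n :: nat where "n > 0" "(x [^] (2::nat)) [^] n \<in> I"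
    using assms(2) by (auto simp: radical_def)
  then have "2 * n > 0 \<and> x [^] (2 * n) \<in> I"
    using assms(1) by (simp add: nat_pow_pow)
  with assms(1) show ?thesis
    unfolding radical_def by blast
qed

text \<open>Settles the case that \<open>sdf_absorbing\<close> leaves out. With one element zero,
  the difference of squares is, up to sign, the square of the other element, and
  \<open>a \<ominus> b\<close> is that element up to sign.\<close>

lemma (in cring) square_minus_square_zeroD:
  assumes "ideal (radical R I) R" and "a \<in> carrier R" "b \<in> carrier R"
    and "a = \<zero> \<or> b = \<zero>" and "a [^] (2::nat) \<ominus> b [^] (2::nat) \<in> radical R I"
  shows "a \<ominus> b \<in> radical R I"
proof -
  interpret J: ideal "radical R I" R by fact
  from assms(4) show ?thesis
  proof
    assume a: "a = \<zero>"
    with assms have "\<ominus> (b [^] (2::nat)) \<in> radical R I"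
      by (simp add: a_minus_def nat_pow_zero)
    then have "b [^] (2::nat) \<in> radical R I"
      using J.a_inv_closed assms(3) by fastforce
    then have "b \<in> radical R I"
      by (rule mem_radical_of_square[OF assms(3)])
    with a assms(3) show ?thesis
      by (simp add: a_minus_def J.a_inv_closed)
  next
    assume b: "b = \<zero>"
    with assms have "a [^] (2::nat) \<in> radical R I"
      by (simp add: a_minus_def nat_pow_zero)
    then have "a \<in> radical R I"
      by (rule mem_radical_of_square[OF assms(2)])
    with b assms(2) show ?thesis
      by (simp add: a_minus_def)
  qed
qed

context module
begin

lemma idealization_carrier: "x \<in> carrier (idealization R M)
    \<longleftrightarrow> fst x \<in> carrier R \<and> snd x \<in> carrier M"
  by (cases x) (simp add: idealization_def)

lemma mem_idealization_ideal: "x \<in> idealization_ideal J M \<longleftrightarrow> fst x \<in> J \<and> snd x \<in> carrier M"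
  by (cases x) (simp add: idealization_ideal_def)

lemma fst_idealization_add: "fst (x \<oplus>\<^bsub>idealization R M\<^esub> y) = fst x \<oplus> fst y"
  by (cases x; cases y) (simp add: idealization_def)

lemma fst_idealization_mult: "fst (x \<otimes>\<^bsub>idealization R M\<^esub> y) = fst x \<otimes> fst y"
  by (cases x; cases y) (simp add: idealization_def)

lemma fst_idealization_one: "fst \<one>\<^bsub>idealization R M\<^esub> = \<one>"
  by (simp add: idealization_def)

lemma fst_idealization_zero: "fst \<zero>\<^bsub>idealization R M\<^esub> = \<zero>"
  by (simp add: idealization_def)

lemma fst_idealization_pow: "fst (x [^]\<^bsub>idealization R M\<^esub> (n::nat)) = fst x [^] n"
  by (induction n) (simp_all add: fst_idealization_one fst_idealization_mult)

text \<open>Negation is not a field of the ring record but is defined through the inverse in the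
  additive monoid, so unfolding \<open>idealization\<close> does not compute it. Uniqueness of
  additive inverses in \<open>R\<close> identifies its first component.\<close>

lemma fst_idealization_minus:
  assumes "x \<in> carrier (idealization R M)" "y \<in> carrier (idealization R M)"
  shows "fst (x \<ominus>\<^bsub>idealization R M\<^esub> y) = fst x \<ominus> fst y"
proof -
  interpret S: cring "idealization R M" by (rule cring_idealization)
  have "fst (\<ominus>\<^bsub>idealization R M\<^esub> y) \<oplus> fst y = \<zero>"
    using S.l_neg[OF assms(2)] by (metis fst_idealization_add fst_idealization_zero)
  then have "fst (\<ominus>\<^bsub>idealization R M\<^esub> y) = \<ominus> fst y"
    using R.minus_equality assms(2) S.a_inv_closed[OF assms(2)]
    by (metis idealization_carrier)
  then show ?thesis
    by (simp add: a_minus_def fst_idealization_add)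
qed

lemma radical_idealization_ideal:
  "radical (idealization R M) (idealization_ideal I M) = idealization_ideal (radical R I) M"
proof -
  interpret S: cring "idealization R M" by (rule cring_idealization)
  have "x \<in> radical (idealization R M) (idealization_ideal I M)
      \<longleftrightarrow> x \<in> idealization_ideal (radical R I) M" for x
    \<comment> \<open>Closure under powers puts the second component of each power of
      \<open>x\<close> in \<open>carrier M\<close>, so only the condition on first components
      remains.\<close>
    using S.nat_pow_closed[of x]
    by (auto simp: radical_def mem_idealization_ideal fst_idealization_pow idealization_carrier)
  then show ?thesis by blast
qed

text \<open>\<open>J\<close> is the preimage of its idealization under the ring homomorphism sending
  \<open>r\<close> to \<open>(r, \<zero>)\<close>, and preimages of ideals are ideals. This recovers
  the ideal property that is part of being sdf-absorbing when passing from the idealization down to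
  \<open>R\<close>.\<close>

lemma ideal_of_ideal_idealization_ideal:
  assumes "ideal (idealization_ideal J M) (idealization R M)"
  shows "ideal J R"
proof -
  interpret J: ideal "idealization_ideal J M" "idealization R M" by fact
  have "(\<lambda>r. (r, \<zero>\<^bsub>M\<^esub>)) \<in> ring_hom R (idealization R M)"
    by (rule ring_hom_memI) (simp_all add: idealization_def)
  then have "ring_hom_ring R (idealization R M) (\<lambda>r. (r, \<zero>\<^bsub>M\<^esub>))"
    using R.ring_axioms J.ring_axioms by (intro ring_hom_ringI2)
  from ring_hom_ring.ideal_vimage[OF this assms]
  have "ideal {r \<in> carrier R. r \<in> J} R"
    by (simp add: mem_idealization_ideal)
  \<comment> \<open>The preimage is taken inside \<open>carrier R\<close>; it is all of
    \<open>J\<close> because an ideal of the idealization lies in its carrier.\<close>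
  moreover have "r \<in> carrier R" if "r \<in> J" for r
    using J.Icarr[of "(r, \<zero>\<^bsub>M\<^esub>)"] that
    by (simp add: mem_idealization_ideal idealization_carrier)
  then have "{r \<in> carrier R. r \<in> J} = J" by blast
  ultimately show ?thesis by simp
qed

text \<open>For an element of the carrier the second component lies in \<open>M\<close> anyway, so
  membership is decided by the first component, which commutes with sums, differences and
  powers.\<close>

lemma square_diff_mem_idealization_ideal:
  assumes "x \<in> carrier (idealization R M)" "y \<in> carrier (idealization R M)"
  shows "x [^]\<^bsub>idealization R M\<^esub> (2::nat) \<ominus>\<^bsub>idealization R M\<^esub> y [^]\<^bsub>idealization R M\<^esub> (2::nat)
      \<in> idealization_ideal J M
    \<longleftrightarrow> fst x [^] (2::nat) \<ominus> fst y [^] (2::nat) \<in> J" (is ?square)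
    and "x \<ominus>\<^bsub>idealization R M\<^esub> y \<in> idealization_ideal J M \<longleftrightarrow> fst x \<ominus> fst y \<in> J" (is ?diff)
    and "x \<oplus>\<^bsub>idealization R M\<^esub> y \<in> idealization_ideal J M \<longleftrightarrow> fst x \<oplus> fst y \<in> J" (is ?sum)
proof -
  interpret S: cring "idealization R M" by (rule cring_idealization)
  have mem: "z \<in> idealization_ideal J M \<longleftrightarrow> fst z \<in> J"
    if "z \<in> carrier (idealization R M)" for z
    using that by (simp add: mem_idealization_ideal idealization_carrier)
  show ?square ?diff ?sum
    using assms by (simp_all add: mem fst_idealization_minus fst_idealization_pow
        fst_idealization_add)
qed

lemma sdf_absorbing_idealization_radical_iff:
  "sdf_absorbing_ideal (idealization_ideal (radical R I) M) (idealization R M)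
    \<longleftrightarrow> sdf_absorbing_ideal (radical R I) R"
proof
  assume "sdf_absorbing_ideal (idealization_ideal (radical R I) M) (idealization R M)"
  then interpret J: sdf_absorbing_ideal "idealization_ideal (radical R I) M" "idealization R M" .
  show "sdf_absorbing_ideal (radical R I) R"
  proof (intro sdf_absorbing_ideal.intro sdf_absorbing_ideal_axioms.intro)
    show "ideal (radical R I) R"
      by (rule ideal_of_ideal_idealization_ideal[OF J.ideal_axioms])
    show "cring R" by (rule R.is_cring)
    fix a b assume ab: "a \<in> carrier R" "b \<in> carrier R" "a \<noteq> \<zero>" "b \<noteq> \<zero>"
      and sq: "a [^] (2::nat) \<ominus> b [^] (2::nat) \<in> radical R I"
    have carr: "(a, \<zero>\<^bsub>M\<^esub>) \<in> carrier (idealization R M)" "(b, \<zero>\<^bsub>M\<^esub>) \<in> carrier (idealization R M)"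
      using ab by (simp_all add: idealization_carrier)
    \<comment> \<open>The embedding of \<open>R\<close> is injective, so non-zero elements stay
      non-zero and the hypothesis applies to their images.\<close>
    have "(a, \<zero>\<^bsub>M\<^esub>) \<noteq> \<zero>\<^bsub>idealization R M\<^esub>" "(b, \<zero>\<^bsub>M\<^esub>) \<noteq> \<zero>\<^bsub>idealization R M\<^esub>"
      using ab by (simp_all add: idealization_def)
    from J.sdf_absorbing[OF carr this] sq
    show "a \<ominus> b \<in> radical R I \<or> a \<oplus> b \<in> radical R I"
      by (simp add: square_diff_mem_idealization_ideal[OF carr])
  qed
next
  assume "sdf_absorbing_ideal (radical R I) R"
  then interpret J: sdf_absorbing_ideal "radical R I" R .
  show "sdf_absorbing_ideal (idealization_ideal (radical R I) M) (idealization R M)"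
  proof (intro sdf_absorbing_ideal.intro sdf_absorbing_ideal_axioms.intro)
    show "ideal (idealization_ideal (radical R I) M) (idealization R M)"
      by (rule ideal_idealization_ideal[OF J.ideal_axioms])
    show "cring (idealization R M)" by (rule cring_idealization)
    fix x y
    assume carr: "x \<in> carrier (idealization R M)" "y \<in> carrier (idealization R M)"
      and "x [^]\<^bsub>idealization R M\<^esub> (2::nat) \<ominus>\<^bsub>idealization R M\<^esub> y [^]\<^bsub>idealization R M\<^esub> (2::nat)
        \<in> idealization_ideal (radical R I) M"
    then have sq: "fst x [^] (2::nat) \<ominus> fst y [^] (2::nat) \<in> radical R I"
      by (simp add: square_diff_mem_idealization_ideal)
    have fst: "fst x \<in> carrier R" "fst y \<in> carrier R"
      using carr by (simp_all add: idealization_carrier)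
    \<comment> \<open>Absorption in \<open>R\<close> applies when both first components are
      non-zero; otherwise the zero case already gives the difference.\<close>
    have "fst x \<ominus> fst y \<in> radical R I \<or> fst x \<oplus> fst y \<in> radical R I"
      using J.sdf_absorbing[OF fst _ _ sq]
        R.square_minus_square_zeroD[OF J.ideal_axioms fst _ sq] by blast
    then show "x \<ominus>\<^bsub>idealization R M\<^esub> y \<in> idealization_ideal (radical R I) M
        \<or> x \<oplus>\<^bsub>idealization R M\<^esub> y \<in> idealization_ideal (radical R I) M"
      by (simp add: square_diff_mem_idealization_ideal[OF carr])
  qed
qed

text \<open>\<open>carrier M\<close> contains zero, so it is a non-empty factor and can be cancelled
  from an equality of products. Properness thus passes between \<open>I\<close> and its
  idealization.\<close>

lemma idealization_ideal_eq_carrier_iff: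
  "idealization_ideal I M = carrier (idealization R M) \<longleftrightarrow> I = carrier R"
proof -
  have "carrier M \<noteq> {}"
    using M.zero_closed by blast
  moreover have "idealization_ideal I M = I \<times> carrier M"
    by (auto simp: idealization_ideal_def)
  ultimately show ?thesis
    by (auto simp: idealization_def times_eq_iff)
qed

end

theorem proposition3p4:
  fixes R :: "('a, 'm) ring_scheme" and M :: "('a, 'b, 'n) module_scheme" and I :: "'a set"
  assumes "cring R" and "module R M" and "ideal I R" and "I \<noteq> carrier R"
  shows "quasi_sdf_absorbing_ideal (idealization_ideal I M) (idealization R M)
    \<longleftrightarrow> quasi_sdf_absorbing_ideal I R"
proof -
  interpret module R M by fact
  \<comment> \<open>Both predicates split into the ideal, ring, properness and radical conditions.
    The first three hold on both sides, and the radical conditions are equivalent.\<close>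
  show ?thesis
    using assms ideal_idealization_ideal[OF assms(3)] cring_idealization
    by (simp add: quasi_sdf_absorbing_ideal_def quasi_sdf_absorbing_ideal_axioms_def
        idealization_ideal_eq_carrier_iff radical_idealization_ideal
        sdf_absorbing_idealization_radical_iff)
qed

end
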